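(* Let $(f^*,x^*,q^*,d^* )\in K_1$ and $h^*\in K_2$. Then $(f^*,x^*,q^*,d^*,h^* )$ is a solution of the variational inequality $$\sum_{r\in O}\sum_{s\in D}\sum_{k\in R_{rs}}(f_k^{rs}-f_k^{rs*})\tfrac1\alpha\ln f_k^{rs*}+\sum_{a\in A}(x_a-x_a^* )t_a(x_a^* )+\sum_{r\in O}\sum_{s\in D}(q_{rs}-q_{rs}^* )\left(\tfrac1\gamma-\tfrac1\alpha\right)\ln q_{rs}^*-\sum_{s\in D}(d_s-d_s^* )A_s(d_s^*,h_s^* )+\sum_{s\in D}(h_s-h_s^* )\left[\tfrac1\beta\ln h_s^*-B_s(d_s^*,h_s^* )\right]\ge0$$ for all $(f,x,q,d,h)\in K_1\times K_2$, if and only if $(f^*,x^*,q^*,d^*,h^* )$ is a combined equilibrium of business land-use.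
   Context: $G=(V,A)$ is a general network with directed link set $A$, origin set $O$ and destination set $D$ (every destination node is a business center). For $r\in O$, $s\in D$, $R_{rs}$ is the set of all simple routes between the origin-destination pair $rs$; $\delta_{ak}^{rs}=1$ if link $a$ is on route $k\in R_{rs}$ and $0$ otherwise. The total travel demand starting from origin $r$ is fixed and given by $O_r$, and the total number of business companies $T$ is a constant with $T>0$. Variables: path flows $f=(f_k^{rs})$, link flows $x=(x_a)$, origin-destination travel demands $q=(q_{rs})$, destination demands $d=(d_s)$ (numbers of travelers choosing $s$), business flows $h=(h_s)$ (numbers of companies located in $s$). $$K_1=\Big\{(f,x,q,d): f_k^{rs}\ge0,\ \sum_{k\in R_{rs}}f_k^{rs}=q_{rs},\ \sum_{s\in D}q_{rs}=O_r,\ \sum_{r\in O}\sum_{s\in D}\sum_{k\in R_{rs}}\delta_{ak}^{rs}f_k^{rs}=x_a,\ \sum_{r\in O}q_{rs}=d_s,\ \ k\in R_{rs},r\in O,s\in D,a\in A\Big\},$$ $$K_2=\Big\{h: h_s\ge0,\ \sum_{s\in D}h_s=T,\ s\in D\Big\}.$$ Parameters: $\alpha,\beta,\gamma>0$, with $\alpha\ge\gamma$ (from logit choice theory). Standing assumptions: each link travel time function $t_a(x_a)$ is separable, convex, continuously differentiable and strictly increasing in $x_a$; for each $s\in D$ the trip attraction function for travelers $A_s(d_s,h_s)$ is continuously differentiable in $(d_s,h_s)$, strictly decreasing in $d_s$, strictly increasing in $h_s$, and strictly concave with respect to $d_s$; for each $s\in D$ the business attraction function for companies $B_s(d_s,h_s)$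 is continuously differentiable in $(d_s,h_s)$, strictly increasing in $d_s$ and strictly decreasing in $h_s$; the functions $t_a$, $A_s$, $B_s$ have the same unit of measurement. Definition: for $(f,x,q,d)\in K_1$ and $h\in K_2$, $(f,x,q,d,h)$ is a (logit-based) combined equilibrium of business land-use if, for all $r\in O$, $s\in D$, $k\in R_{rs}$, $$q_{rs}=O_r\frac{\exp\{-\gamma[v_{rs}-A_s(d_s,h_s)]\}}{\sum_{j\in D}\exp\{-\gamma[v_{rj}-A_j(d_j,h_j)]\}},\quad f_k^{rs}=q_{rs}\frac{\exp\{-\alpha\sum_{a\in A}\delta_{ak}^{rs}t_a(x_a)\}}{\sum_{j\in R_{rs}}\exp\{-\alpha\sum_{a\in A}\delta_{aj}^{rs}t_a(x_a)\}},\quad h_s=T\frac{\exp[\beta B_s(d_s,h_s)]}{\sum_{j\in D}\exp[\beta B_j(d_j,h_j)]},$$ where $v_{rs}=-\frac1\alpha\ln\{\sum_{j\in R_{rs}}\exp[-\alpha\sum_{a\in A}\delta_{aj}^{rs}t_a(x_a)]\}$ is the logit-based expected travel time between the pair $rs$. *)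

theory Defs
  imports "HOL-Analysis.Analysis" "Graph_Theory.Arc_Walk"
begin

section \<open>Regularity notions\<close>

text \<open>The derivative is taken within \<open>S\<close>, so on a domain such as \<open>{0..}\<close> it is one-sided at
  the boundary; the library's \<^const>\<open>C1_differentiable_on\<close> is two-sided and univariate.\<close>

definition C1_on :: "('a::real_normed_vector \<Rightarrow> 'b::real_normed_vector) \<Rightarrow> 'a set \<Rightarrow> bool" where
  "C1_on g S \<longleftrightarrow> (\<exists>g' :: 'a \<Rightarrow> 'a \<Rightarrow>\<^sub>L 'b.
     (\<forall>p\<in>S. (g has_derivative blinfun_apply (g' p)) (at p within S)) \<and> continuous_on S g')"

definition strictly_concave_on :: "real set \<Rightarrow> (real \<Rightarrow> real) \<Rightarrow> bool" where
  "strictly_concave_on S g \<longleftrightarrow> convex S \<and>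
     (\<forall>u\<in>S. \<forall>w\<in>S. \<forall>l. u \<noteq> w \<and> 0 < l \<and> l < 1 \<longrightarrow>
        (1 - l) * g u + l * g w < g ((1 - l) * u + l * w))"

definition link_time :: "(real \<Rightarrow> real) \<Rightarrow> bool" where
  "link_time \<tau> \<longleftrightarrow> convex_on {0..} \<tau> \<and> C1_on \<tau> {0..} \<and> strict_mono_on {0..} \<tau>"

definition trip_attraction :: "(real \<Rightarrow> real \<Rightarrow> real) \<Rightarrow> bool" where
  "trip_attraction A \<longleftrightarrow>
     C1_on (\<lambda>(d, h). A d h) ({0..} \<times> {0..}) \<and>
     (\<forall>h\<ge>0. strict_antimono_on {0..} (\<lambda>d. A d h)) \<and>
     (\<forall>d\<ge>0. strict_mono_on {0..} (\<lambda>h. A d h)) \<and>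
     (\<forall>h\<ge>0. strictly_concave_on {0..} (\<lambda>d. A d h))"

definition business_attraction :: "(real \<Rightarrow> real \<Rightarrow> real) \<Rightarrow> bool" where
  "business_attraction B \<longleftrightarrow>
     C1_on (\<lambda>(d, h). B d h) ({0..} \<times> {0..}) \<and>
     (\<forall>h\<ge>0. strict_mono_on {0..} (\<lambda>d. B d h)) \<and>
     (\<forall>d\<ge>0. strict_antimono_on {0..} (\<lambda>h. B d h))"

section \<open>Routes and feasible sets\<close>

text \<open>Routes are lists of arcs without repeated vertices. Flow variables are total functions;
  only their values at origins, destinations, routes and links are ever used.\<close>

type_synonym ('v, 'e) path_flow = "'v \<Rightarrow> 'v \<Rightarrow> 'e awalk \<Rightarrow> real"
type_synonym 'e link_flow = "'e \<Rightarrow> real"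
type_synonym 'v od_demand = "'v \<Rightarrow> 'v \<Rightarrow> real"
type_synonym 'v dest_vec = "'v \<Rightarrow> real"

definition routes :: "('v, 'e) pre_digraph \<Rightarrow> 'v \<Rightarrow> 'v \<Rightarrow> 'e awalk set" where
  "routes G r s = {k. pre_digraph.apath G r k s}"

definition incid :: "'e \<Rightarrow> 'e awalk \<Rightarrow> real" where
  "incid a k = of_bool (a \<in> set k)"

definition K1 :: "('v, 'e) pre_digraph \<Rightarrow> 'v set \<Rightarrow> 'v set \<Rightarrow> ('v \<Rightarrow> real) \<Rightarrow>
    (('v, 'e) path_flow \<times> 'e link_flow \<times> 'v od_demand \<times> 'v dest_vec) set" where
  "K1 G Or De dem = {(f, x, q, d).
     (\<forall>r\<in>Or. \<forall>s\<in>De. \<forall>k\<in>routes G r s. 0 \<le> f r s k) \<and>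
     (\<forall>r\<in>Or. \<forall>s\<in>De. (\<Sum>k\<in>routes G r s. f r s k) = q r s) \<and>
     (\<forall>r\<in>Or. (\<Sum>s\<in>De. q r s) = dem r) \<and>
     (\<forall>a\<in>arcs G. (\<Sum>r\<in>Or. \<Sum>s\<in>De. \<Sum>k\<in>routes G r s. incid a k * f r s k) = x a) \<and>
     (\<forall>s\<in>De. (\<Sum>r\<in>Or. q r s) = d s)}"

definition K2 :: "'v set \<Rightarrow> real \<Rightarrow> 'v dest_vec set" where
  "K2 De T = {h. (\<forall>s\<in>De. 0 \<le> h s) \<and> (\<Sum>s\<in>De. h s) = T}"

section \<open>Combined equilibrium\<close>

definition route_time :: "('v, 'e) pre_digraph \<Rightarrow> ('e \<Rightarrow> real \<Rightarrow> real) \<Rightarrow> 'e link_flow \<Rightarrow>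
    'e awalk \<Rightarrow> real" where
  "route_time G t x k = (\<Sum>a\<in>arcs G. incid a k * t a (x a))"

definition expected_time :: "('v, 'e) pre_digraph \<Rightarrow> ('e \<Rightarrow> real \<Rightarrow> real) \<Rightarrow> real \<Rightarrow>
    'e link_flow \<Rightarrow> 'v \<Rightarrow> 'v \<Rightarrow> real" where
  "expected_time G t \<alpha> x r s =
     - (1 / \<alpha>) * ln (\<Sum>j\<in>routes G r s. exp (- \<alpha> * route_time G t x j))"

definition combined_equilibrium ::
  "('v, 'e) pre_digraph \<Rightarrow> 'v set \<Rightarrow> 'v set \<Rightarrow> ('v \<Rightarrow> real) \<Rightarrow> real \<Rightarrow>
   ('e \<Rightarrow> real \<Rightarrow> real) \<Rightarrow> ('v \<Rightarrow> real \<Rightarrow> real \<Rightarrow> real) \<Rightarrow> ('v \<Rightarrow> real \<Rightarrow> real \<Rightarrow> real) \<Rightarrow>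
   real \<Rightarrow> real \<Rightarrow> real \<Rightarrow>
   ('v, 'e) path_flow \<Rightarrow> 'e link_flow \<Rightarrow> 'v od_demand \<Rightarrow> 'v dest_vec \<Rightarrow> 'v dest_vec \<Rightarrow> bool" where
  "combined_equilibrium G Or De dem T t A B \<alpha> \<beta> \<gamma> f x q d h \<longleftrightarrow>
     (f, x, q, d) \<in> K1 G Or De dem \<and> h \<in> K2 De T \<and>
     (\<forall>r\<in>Or. \<forall>s\<in>De.
        q r s = dem r * (exp (- \<gamma> * (expected_time G t \<alpha> x r s - A s (d s) (h s))) /
          (\<Sum>j\<in>De. exp (- \<gamma> * (expected_time G t \<alpha> x r j - A j (d j) (h j)))))) \<and>
     (\<forall>r\<in>Or. \<forall>s\<in>De. \<forall>k\<in>routes G r s.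
        f r s k = q r s * (exp (- \<alpha> * route_time G t x k) /
          (\<Sum>j\<in>routes G r s. exp (- \<alpha> * route_time G t x j)))) \<and>
     (\<forall>s\<in>De.
        h s = T * (exp (\<beta> * B s (d s) (h s)) / (\<Sum>j\<in>De. exp (\<beta> * B j (d j) (h j)))))"

section \<open>Variational inequality\<close>

text \<open>Points of \<open>K1\<close> and \<open>K2\<close> may have zero components, where HOL's total real function
  has \<open>ln 0 = 0\<close>. Taken literally this would admit spurious boundary solutions. The logarithm is
  therefore extended-real valued, with \<open>ln 0 = - \<infinity>\<close> (and \<open>0 * \<infinity> = 0\<close>, as always in
  \<^typ>\<open>ereal\<close>). On feasible points all infinite summands are \<open>- \<infinity>\<close>, so \<open>\<infinity> - \<infinity>\<close> never occurs
  when \<open>\<alpha> \<ge> \<gamma> > 0\<close> and \<open>\<beta> > 0\<close>; the lemma \<open>VI_lhs_pos\<close> below covers strictly positive arguments.\<close>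

definition eln :: "real \<Rightarrow> ereal" where
  "eln y = (if y \<le> 0 then - \<infinity> else ereal (ln y))"

definition VI_lhs ::
  "('v, 'e) pre_digraph \<Rightarrow> 'v set \<Rightarrow> 'v set \<Rightarrow>
   ('e \<Rightarrow> real \<Rightarrow> real) \<Rightarrow> ('v \<Rightarrow> real \<Rightarrow> real \<Rightarrow> real) \<Rightarrow> ('v \<Rightarrow> real \<Rightarrow> real \<Rightarrow> real) \<Rightarrow>
   real \<Rightarrow> real \<Rightarrow> real \<Rightarrow>
   ('v, 'e) path_flow \<Rightarrow> 'e link_flow \<Rightarrow> 'v od_demand \<Rightarrow> 'v dest_vec \<Rightarrow> 'v dest_vec \<Rightarrow>
   ('v, 'e) path_flow \<Rightarrow> 'e link_flow \<Rightarrow> 'v od_demand \<Rightarrow> 'v dest_vec \<Rightarrow> 'v dest_vec \<Rightarrow> ereal" where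
  "VI_lhs G Or De t A B \<alpha> \<beta> \<gamma> fs xs qs ds hs f x q d h =
     (\<Sum>r\<in>Or. \<Sum>s\<in>De. \<Sum>k\<in>routes G r s.
        ereal (f r s k - fs r s k) * (ereal (1 / \<alpha>) * eln (fs r s k)))
     + ereal (\<Sum>a\<in>arcs G. (x a - xs a) * t a (xs a))
     + (\<Sum>r\<in>Or. \<Sum>s\<in>De. ereal (q r s - qs r s) * (ereal (1 / \<gamma> - 1 / \<alpha>) * eln (qs r s)))
     - ereal (\<Sum>s\<in>De. (d s - ds s) * A s (ds s) (hs s))
     + (\<Sum>s\<in>De. ereal (h s - hs s) * (ereal (1 / \<beta>) * eln (hs s) - ereal (B s (ds s) (hs s))))"

definition VI_solution ::
  "('v, 'e) pre_digraph \<Rightarrow> 'v set \<Rightarrow> 'v set \<Rightarrow> ('v \<Rightarrow> real) \<Rightarrow> real \<Rightarrow>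
   ('e \<Rightarrow> real \<Rightarrow> real) \<Rightarrow> ('v \<Rightarrow> real \<Rightarrow> real \<Rightarrow> real) \<Rightarrow> ('v \<Rightarrow> real \<Rightarrow> real \<Rightarrow> real) \<Rightarrow>
   real \<Rightarrow> real \<Rightarrow> real \<Rightarrow>
   ('v, 'e) path_flow \<Rightarrow> 'e link_flow \<Rightarrow> 'v od_demand \<Rightarrow> 'v dest_vec \<Rightarrow> 'v dest_vec \<Rightarrow> bool" where
  "VI_solution G Or De dem T t A B \<alpha> \<beta> \<gamma> fs xs qs ds hs \<longleftrightarrow>
     (\<forall>((f, x, q, d), h) \<in> K1 G Or De dem \<times> K2 De T.
        VI_lhs G Or De t A B \<alpha> \<beta> \<gamma> fs xs qs ds hs f x q d h \<ge> 0)"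

lemma VI_lhs_pos:
  assumes "\<And>r s k. r \<in> Or \<Longrightarrow> s \<in> De \<Longrightarrow> k \<in> routes G r s \<Longrightarrow> 0 < fs r s k"
    and "\<And>r s. r \<in> Or \<Longrightarrow> s \<in> De \<Longrightarrow> 0 < qs r s"
    and "\<And>s. s \<in> De \<Longrightarrow> 0 < hs s"
  shows "VI_lhs G Or De t A B \<alpha> \<beta> \<gamma> fs xs qs ds hs f x q d h = ereal (
     (\<Sum>r\<in>Or. \<Sum>s\<in>De. \<Sum>k\<in>routes G r s. (f r s k - fs r s k) * (1 / \<alpha> * ln (fs r s k)))
     + (\<Sum>a\<in>arcs G. (x a - xs a) * t a (xs a))
     + (\<Sum>r\<in>Or. \<Sum>s\<in>De. (q r s - qs r s) * ((1 / \<gamma> - 1 / \<alpha>) * ln (qs r s)))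
     - (\<Sum>s\<in>De. (d s - ds s) * A s (ds s) (hs s))
     + (\<Sum>s\<in>De. (h s - hs s) * (1 / \<beta> * ln (hs s) - B s (ds s) (hs s))))"
proof -
  have e: "eln y = ereal (ln y)" if "0 < y" for y
    using that by (simp add: eln_def)
  have 1: "(\<Sum>r\<in>Or. \<Sum>s\<in>De. \<Sum>k\<in>routes G r s.
        ereal (f r s k - fs r s k) * (ereal (1 / \<alpha>) * eln (fs r s k)))
      = ereal (\<Sum>r\<in>Or. \<Sum>s\<in>De. \<Sum>k\<in>routes G r s. (f r s k - fs r s k) * (1 / \<alpha> * ln (fs r s k)))"
    unfolding sum_ereal[symmetric] by (intro sum.cong refl) (simp add: e assms)
  have 2: "(\<Sum>r\<in>Or. \<Sum>s\<in>De. ereal (q r s - qs r s) * (ereal (1 / \<gamma> - 1 / \<alpha>) * eln (qs r s)))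
      = ereal (\<Sum>r\<in>Or. \<Sum>s\<in>De. (q r s - qs r s) * ((1 / \<gamma> - 1 / \<alpha>) * ln (qs r s)))"
    unfolding sum_ereal[symmetric] by (intro sum.cong refl) (simp add: e assms)
  have 3: "(\<Sum>s\<in>De. ereal (h s - hs s) * (ereal (1 / \<beta>) * eln (hs s) - ereal (B s (ds s) (hs s))))
      = ereal (\<Sum>s\<in>De. (h s - hs s) * (1 / \<beta> * ln (hs s) - B s (ds s) (hs s)))"
    unfolding sum_ereal[symmetric] by (intro sum.cong refl) (simp add: e assms)
  show ?thesis
    unfolding VI_lhs_def 1 2 3 by simp
qed

end

theory Submission
  imports Defs
begin

text \<open>
  A feasible point is determined by its path flow \<open>f\<close> and its business flow \<open>h\<close>: link flows,
  demands and destination totals are linear images of \<open>f\<close>. Pulling the link, demand and attraction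
  terms of the variational inequality back along these linear maps turns its left-hand side into
  \<open>\<Sum> (f - f\<^sup>*) c + \<Sum> (h - h\<^sup>*) e\<close>, where the \<^emph>\<open>generalised cost\<close> \<open>c\<close> of a route and the
  \<^emph>\<open>business cost\<close> \<open>e\<close> of a destination are evaluated at the reference point (\<open>VI_lhs_linear\<close>).
  The feasible set is a product of simplices: one for each origin, whose coordinates are all pairs of
  a destination and a route to it, and one for \<open>h\<close>. At an interior point of a simplex a linear form
  is minimal iff its coefficients are all equal (\<open>simplex_minimal_iff_constant\<close>). So, at positive
  points, the inequality says that the costs equalise (\<open>VI_solution_iff_costs_constant\<close>).

  The costs are logarithms of flows plus terms that do not contain the flow in question, and an
  equation \<open>ln u\<^sub>i = w\<^sub>i + const\<close> is exactly the logit formula for \<open>u\<close> (\<open>logit_iff_constant\<close>).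
  For an origin this has to be used on two levels. Equal costs among the routes to one destination
  give the logit split over routes; substituting that split, the generalised cost collapses to
  \<open>(1/\<gamma>) ln q + v - A\<close>, with \<open>v\<close> the expected travel time (\<open>gen_cost_route_logit\<close>), and equality
  across destinations becomes the logit split over destinations.

  Positivity holds on both sides. Logit shares are positive, and a solution of the inequality cannot
  have a vanishing component, because moving towards the uniform flow would contribute \<open>- \<infinity>\<close>
  through \<open>ln 0\<close> (\<open>VI_solution_positive\<close>). The exception is an origin without demand: there every
  feasible flow is zero, and both the inequality and the equilibrium conditions are void. Hence
  positivity and equal costs are only claimed for origins with \<open>dem r > 0\<close>.
\<close>

section \<open>Linear forms on a simplex and logit shares\<close>

text \<open>If two coefficients differ, moving the whole mass of the dearer coordinate to the cheaper one
  keeps the point in the simplex and makes the linear form negative; this uses that the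
  mass moved is positive.\<close>

lemma simplex_minimal_iff_constant:
  fixes u c :: "'i \<Rightarrow> real"
  assumes fin: "finite I" and pos: "\<And>i. i \<in> I \<Longrightarrow> 0 < u i"
  shows "(\<forall>v. (\<forall>i\<in>I. 0 \<le> v i) \<and> sum v I = sum u I \<longrightarrow> 0 \<le> (\<Sum>i\<in>I. (v i - u i) * c i))
    \<longleftrightarrow> c constant_on I"
proof
  assume min: "\<forall>v. (\<forall>i\<in>I. 0 \<le> v i) \<and> sum v I = sum u I \<longrightarrow> 0 \<le> (\<Sum>i\<in>I. (v i - u i) * c i)"
  have "c i \<le> c j" if ij: "i \<in> I" "j \<in> I" for i j
  proof -
    define e where "e l = (of_bool (l = j) - of_bool (l = i)) * u i" for l
    have "\<forall>l\<in>I. 0 \<le> u l + e l"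
      using pos ij by (auto simp: e_def less_imp_le add_nonneg_nonneg)
    moreover have "sum (\<lambda>l. u l + e l) I = sum u I"
      using fin ij by (simp add: e_def sum.distrib sum_distrib_right[symmetric] sum_subtractf
          of_bool_def)
    ultimately have "0 \<le> (\<Sum>l\<in>I. ((u l + e l) - u l) * c l)"
      using min[rule_format, of "\<lambda>l. u l + e l"] by blast
    also have "\<dots> = (\<Sum>l\<in>I. (if l = j then u i * c l else 0) - (if l = i then u i * c l else 0))"
      by (rule sum.cong) (auto simp: e_def algebra_simps)
    also have "\<dots> = u i * (c j - c i)"
      using fin ij by (simp add: sum_subtractf algebra_simps)
    finally show ?thesis
      using pos[OF ij(1)] by (simp add: zero_le_mult_iff)
  qed
  then have "c i = c j" if "i \<in> I" "j \<in> I" for i j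
    using that by (simp add: antisym)
  then show "c constant_on I"
    unfolding constant_on_def by metis
next
  assume "c constant_on I"
  then obtain y where y: "\<And>i. i \<in> I \<Longrightarrow> c i = y"
    by (auto simp: constant_on_def)
  have "(\<Sum>i\<in>I. (v i - u i) * c i) = (sum v I - sum u I) * y" for v
    by (simp add: y sum_distrib_right[symmetric] sum_subtractf)
  then show "\<forall>v. (\<forall>i\<in>I. 0 \<le> v i) \<and> sum v I = sum u I \<longrightarrow> 0 \<le> (\<Sum>i\<in>I. (v i - u i) * c i)"
    by simp
qed

lemma logit_iff_constant:
  fixes u w :: "'i \<Rightarrow> real"
  assumes fin: "finite I" and ne: "I \<noteq> {}" and pos: "\<And>i. i \<in> I \<Longrightarrow> 0 < u i"
  shows "(\<forall>i\<in>I. u i = sum u I * (exp (w i) / (\<Sum>j\<in>I. exp (w j))))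
    \<longleftrightarrow> (\<lambda>i. ln (u i) - w i) constant_on I"
proof
  define Z where "Z = (\<Sum>j\<in>I. exp (w j))"
  have Z: "0 < Z"
    unfolding Z_def using fin ne by (intro sum_pos) auto
  have m: "0 < sum u I"
    using fin ne pos by (intro sum_pos) auto
  assume "\<forall>i\<in>I. u i = sum u I * (exp (w i) / (\<Sum>j\<in>I. exp (w j)))"
  then have u: "u i = sum u I * (exp (w i) / Z)" if "i \<in> I" for i
    using that unfolding Z_def by blast
  have "ln (u i) - w i = ln (sum u I) - ln Z" if "i \<in> I" for i
  proof -
    have "ln (u i) = ln (sum u I * (exp (w i) / Z))"
      using u[OF that] by simp
    also have "\<dots> = ln (sum u I) + (w i - ln Z)"
      using m Z by (simp add: ln_mult ln_div)
    finally show ?thesis by simp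
  qed
  then show "(\<lambda>i. ln (u i) - w i) constant_on I"
    by (auto simp: constant_on_def)
next
  define Z where "Z = (\<Sum>j\<in>I. exp (w j))"
  have Z: "0 < Z"
    unfolding Z_def using fin ne by (intro sum_pos) auto
  assume "(\<lambda>i. ln (u i) - w i) constant_on I"
  then obtain y where y: "\<And>i. i \<in> I \<Longrightarrow> ln (u i) - w i = y"
    by (auto simp: constant_on_def)
  have u: "u i = exp y * exp (w i)" if "i \<in> I" for i
  proof -
    have "u i = exp (ln (u i))"
      using pos[OF that] by simp
    also have "ln (u i) = y + w i"
      using y[OF that] by simp
    finally show ?thesis by (simp add: exp_add)
  qed
  have "sum u I = exp y * Z"
    unfolding Z_def by (simp add: u sum_distrib_left)
  then show "\<forall>i\<in>I. u i = sum u I * (exp (w i) / (\<Sum>j\<in>I. exp (w j)))"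
    using Z u by (simp flip: Z_def)
qed

text \<open>In \<^typ>\<open>ereal\<close> the sum \<open>\<infinity> + - \<infinity>\<close> is \<open>\<infinity>\<close>, so a summand \<open>- \<infinity>\<close> is only decisive
  when no summand is \<open>\<infinity>\<close>.\<close>

lemma sum_eq_MInfty_iff:
  fixes g :: "'i \<Rightarrow> ereal"
  assumes "finite I" and "\<And>i. i \<in> I \<Longrightarrow> g i \<noteq> \<infinity>"
  shows "sum g I = - \<infinity> \<longleftrightarrow> (\<exists>i\<in>I. g i = - \<infinity>)"
  using assms by (induction I) (auto simp: sum_Pinfty)

lemma eln_term_not_PInfty:
  assumes "0 \<le> c" and "0 \<le> v" and "0 \<le> u"
  shows "ereal (v - u) * (ereal c * eln u) \<noteq> \<infinity>"
  using assms by (cases "c = 0") (auto simp: eln_def)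

lemma eln_term_MInfty:
  assumes "0 < c" and "0 < v" and "u = 0"
  shows "ereal (v - u) * (ereal c * eln u) = - \<infinity>"
  using assms by (auto simp: eln_def)

lemma eln_term_real:
  assumes "0 < u \<or> v = u"
  shows "ereal (v - u) * (ereal c * eln u) = ereal ((v - u) * (c * ln u))"
  using assms by (auto simp: eln_def zero_ereal_def[symmetric])

section \<open>The feasible set as a product of simplices\<close>

text \<open>The reference point is fixed together with the network, because all costs are evaluated there.\<close>

locale land_use =
  fixes G :: "('v, 'e) pre_digraph"
    and Or De :: "'v set"
    and dem :: "'v \<Rightarrow> real"
    and T \<alpha> \<beta> \<gamma> :: real
    and t :: "'e \<Rightarrow> real \<Rightarrow> real"
    and A B :: "'v \<Rightarrow> real \<Rightarrow> real \<Rightarrow> real"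
    and fs :: "('v, 'e) path_flow" and xs :: "'e link_flow"
    and qs :: "'v od_demand" and ds hs :: "'v dest_vec"
  assumes G: "fin_digraph G"
    and finite_Or [simp]: "finite Or" and finite_De [simp]: "finite De"
    and routes_nonempty: "\<And>r s. r \<in> Or \<Longrightarrow> s \<in> De \<Longrightarrow> routes G r s \<noteq> {}"
    and T: "T > 0" and \<alpha>: "\<alpha> > 0" and \<beta>: "\<beta> > 0" and \<gamma>: "\<gamma> > 0" and \<alpha>\<gamma>: "\<alpha> \<ge> \<gamma>"
    and K1s: "(fs, xs, qs, ds) \<in> K1 G Or De dem"
    and K2s: "hs \<in> K2 De T"
begin

abbreviation dest_routes :: "'v \<Rightarrow> ('v \<times> 'e awalk) set" where
  "dest_routes r \<equiv> Sigma De (routes G r)"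

definition gen_cost :: "'v \<Rightarrow> 'v \<Rightarrow> 'e awalk \<Rightarrow> real" where
  "gen_cost r s k = 1 / \<alpha> * ln (fs r s k) + route_time G t xs k
     + (1 / \<gamma> - 1 / \<alpha>) * ln (qs r s) - A s (ds s) (hs s)"

definition bus_cost :: "'v \<Rightarrow> real" where
  "bus_cost s = 1 / \<beta> * ln (hs s) - B s (ds s) (hs s)"

definition positive_flows :: bool where
  "positive_flows \<longleftrightarrow>
     (\<forall>r\<in>Or. 0 < dem r \<longrightarrow> (\<forall>s\<in>De. \<forall>k\<in>routes G r s. 0 < fs r s k)) \<and> (\<forall>s\<in>De. 0 < hs s)"

lemma finite_routes [simp]: "finite (routes G r s)"
  unfolding routes_def by (rule fin_digraph.apaths_finite[OF G])

lemma De_nonempty: "De \<noteq> {}"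
  using K2s T by (auto simp: K2_def)

lemma demand_coeff_nonneg: "0 \<le> 1 / \<gamma> - 1 / \<alpha>"
  using \<alpha>\<gamma> \<gamma> \<alpha> by (simp add: frac_le)

lemma sum_dest_routes:
  "(\<Sum>s\<in>De. \<Sum>k\<in>routes G r s. g s k) = (\<Sum>(s, k)\<in>dest_routes r. g s k)"
  by (simp add: sum.Sigma)

lemma K1D:
  assumes "(f, x, q, d) \<in> K1 G Or De dem"
  shows "r \<in> Or \<Longrightarrow> s \<in> De \<Longrightarrow> k \<in> routes G r s \<Longrightarrow> 0 \<le> f r s k"
    and "r \<in> Or \<Longrightarrow> s \<in> De \<Longrightarrow> q r s = (\<Sum>k\<in>routes G r s. f r s k)"
    and "r \<in> Or \<Longrightarrow> (\<Sum>s\<in>De. q r s) = dem r"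
    and "a \<in> arcs G \<Longrightarrow> x a = (\<Sum>r\<in>Or. \<Sum>s\<in>De. \<Sum>k\<in>routes G r s. incid a k * f r s k)"
    and "s \<in> De \<Longrightarrow> d s = (\<Sum>r\<in>Or. q r s)"
  using assms by (auto simp: K1_def)

lemma K1_sum_flow:
  assumes "(f, x, q, d) \<in> K1 G Or De dem" and "r \<in> Or"
  shows "(\<Sum>(s, k)\<in>dest_routes r. f r s k) = dem r"
  using K1D(2,3)[OF assms(1)] assms(2) by (simp flip: sum_dest_routes)

lemma K1_demand_nonneg:
  assumes "(f, x, q, d) \<in> K1 G Or De dem" and "r \<in> Or" and "s \<in> De"
  shows "0 \<le> q r s"
  using K1D(1,2)[OF assms(1)] assms(2,3) by (simp add: sum_nonneg)

lemma dem_nonneg: "r \<in> Or \<Longrightarrow> 0 \<le> dem r"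
  using K1D(3)[OF K1s] K1_demand_nonneg[OF K1s] by (metis sum_nonneg)

lemma K1_zero_demand:
  assumes K: "(f, x, q, d) \<in> K1 G Or De dem" and r: "r \<in> Or" "dem r = 0"
  shows "s \<in> De \<Longrightarrow> q r s = 0"
    and "s \<in> De \<Longrightarrow> k \<in> routes G r s \<Longrightarrow> f r s k = 0"
proof -
  show q: "q r s = 0" if "s \<in> De" for s
    using K1D(3)[OF K r(1)] r(2) K1_demand_nonneg[OF K r(1)] that
    by (simp add: sum_nonneg_eq_0_iff)
  show "f r s k = 0" if "s \<in> De" "k \<in> routes G r s"
    using K1D(1)[OF K r(1) that(1)] K1D(2)[OF K r(1) that(1)] q[OF that(1)] that(2)
    by (simp add: sum_nonneg_eq_0_iff)
qed

text \<open>Path flows are the free coordinates of \<^const>\<open>K1\<close>: test points for the variational inequality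
  can be given by their path flows alone.\<close>

lemma K1_extend:
  assumes "\<And>r s k. r \<in> Or \<Longrightarrow> s \<in> De \<Longrightarrow> k \<in> routes G r s \<Longrightarrow> 0 \<le> f r s k"
    and "\<And>r. r \<in> Or \<Longrightarrow> (\<Sum>(s, k)\<in>dest_routes r. f r s k) = dem r"
  obtains x q d where "(f, x, q, d) \<in> K1 G Or De dem"
proof
  show "(f, \<lambda>a. \<Sum>r\<in>Or. \<Sum>s\<in>De. \<Sum>k\<in>routes G r s. incid a k * f r s k,
      \<lambda>r s. \<Sum>k\<in>routes G r s. f r s k, \<lambda>s. \<Sum>r\<in>Or. \<Sum>k\<in>routes G r s. f r s k) \<in> K1 G Or De dem"
    using assms by (simp add: K1_def sum_dest_routes)
qed

lemma demand_pos:
  assumes "positive_flows" and "r \<in> Or" and "0 < dem r" and "s \<in> De"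
  shows "0 < qs r s"
  using assms K1D(2)[OF K1s assms(2,4)] routes_nonempty[OF assms(2,4)]
  by (simp add: positive_flows_def sum_pos)

section \<open>The variational inequality at positive points\<close>

text \<open>The terms in \<open>x\<close>, \<open>q\<close> and \<open>d\<close> are carried over to path flows by exchanging sums: a flow change
  on a route changes each of its links, its demand and its destination total by the same amount.
  Extended-real terms are finite because a vanishing reference flow only occurs at an origin without
  demand, where the difference it is multiplied with vanishes too.\<close>

lemma VI_lhs_linear:
  assumes pos: "positive_flows" and K: "(f, x, q, d) \<in> K1 G Or De dem"
  shows "VI_lhs G Or De t A B \<alpha> \<beta> \<gamma> fs xs qs ds hs f x q d h = ereal (
     (\<Sum>r\<in>Or. \<Sum>(s, k)\<in>dest_routes r. (f r s k - fs r s k) * gen_cost r s k)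
     + (\<Sum>s\<in>De. (h s - hs s) * bus_cost s))"
proof -
  have zero: "dem r = 0" if "r \<in> Or" "\<not> 0 < dem r" for r
    using that dem_nonneg[OF that(1)] by simp
  have f_pos: "0 < fs r s k \<or> f r s k = fs r s k" if "r \<in> Or" "s \<in> De" "k \<in> routes G r s" for r s k
    using that pos zero[OF that(1)] K1_zero_demand(2)[OF K that(1)]
      K1_zero_demand(2)[OF K1s that(1)]
    by (cases "0 < dem r") (auto simp: positive_flows_def)
  have q_pos: "0 < qs r s \<or> q r s = qs r s" if "r \<in> Or" "s \<in> De" for r s
    using that demand_pos[OF pos that(1) _ that(2)] zero[OF that(1)]
      K1_zero_demand(1)[OF K that(1)] K1_zero_demand(1)[OF K1s that(1)]
    by (cases "0 < dem r") auto
  have h_pos: "0 < hs s" if "s \<in> De" for s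
    using that pos by (simp add: positive_flows_def)
  have 1: "(\<Sum>r\<in>Or. \<Sum>s\<in>De. \<Sum>k\<in>routes G r s.
        ereal (f r s k - fs r s k) * (ereal (1 / \<alpha>) * eln (fs r s k)))
      = ereal (\<Sum>r\<in>Or. \<Sum>s\<in>De. \<Sum>k\<in>routes G r s. (f r s k - fs r s k) * (1 / \<alpha> * ln (fs r s k)))"
    unfolding sum_ereal[symmetric] by (intro sum.cong refl eln_term_real f_pos)
  have "(\<Sum>r\<in>Or. \<Sum>s\<in>De. ereal (q r s - qs r s) * (ereal (1 / \<gamma> - 1 / \<alpha>) * eln (qs r s)))
      = ereal (\<Sum>r\<in>Or. \<Sum>s\<in>De. (q r s - qs r s) * ((1 / \<gamma> - 1 / \<alpha>) * ln (qs r s)))"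
    unfolding sum_ereal[symmetric] by (intro sum.cong refl eln_term_real q_pos)
  also have "\<dots> = ereal (\<Sum>r\<in>Or. \<Sum>s\<in>De. \<Sum>k\<in>routes G r s.
      (f r s k - fs r s k) * ((1 / \<gamma> - 1 / \<alpha>) * ln (qs r s)))"
    by (intro arg_cong[where f=ereal] sum.cong refl)
      (simp add: K1D(2)[OF K] K1D(2)[OF K1s] sum_distrib_right[symmetric] sum_subtractf)
  finally have 2: "(\<Sum>r\<in>Or. \<Sum>s\<in>De. ereal (q r s - qs r s) * (ereal (1 / \<gamma> - 1 / \<alpha>) * eln (qs r s)))
    = \<dots>" .
  have 3: "(\<Sum>s\<in>De. ereal (h s - hs s) * (ereal (1 / \<beta>) * eln (hs s) - ereal (B s (ds s) (hs s))))
      = ereal (\<Sum>s\<in>De. (h s - hs s) * bus_cost s)"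
    unfolding sum_ereal[symmetric]
    by (intro sum.cong refl) (use h_pos in \<open>simp add: eln_def bus_cost_def not_le\<close>)
  have "(\<Sum>s\<in>De. (d s - ds s) * A s (ds s) (hs s))
      = (\<Sum>s\<in>De. \<Sum>r\<in>Or. \<Sum>k\<in>routes G r s. (f r s k - fs r s k) * A s (ds s) (hs s))"
    by (intro sum.cong refl) (simp add: K1D(2,5)[OF K] K1D(2,5)[OF K1s]
        sum_distrib_right[symmetric] sum_subtractf)
  also have "\<dots> = (\<Sum>r\<in>Or. \<Sum>s\<in>De. \<Sum>k\<in>routes G r s. (f r s k - fs r s k) * A s (ds s) (hs s))"
    by (rule sum.swap)
  finally have 4: "(\<Sum>s\<in>De. (d s - ds s) * A s (ds s) (hs s)) = \<dots>" .
  have "(\<Sum>a\<in>arcs G. (x a - xs a) * t a (xs a))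
      = (\<Sum>a\<in>arcs G. \<Sum>r\<in>Or. \<Sum>s\<in>De. \<Sum>k\<in>routes G r s.
          (f r s k - fs r s k) * (incid a k * t a (xs a)))"
    by (intro sum.cong refl) (simp add: K1D(4)[OF K] K1D(4)[OF K1s]
        sum_distrib_right sum_subtractf algebra_simps)
  also have "\<dots> = (\<Sum>r\<in>Or. \<Sum>s\<in>De. \<Sum>k\<in>routes G r s. \<Sum>a\<in>arcs G.
          (f r s k - fs r s k) * (incid a k * t a (xs a)))"
    by (simp only: sum.swap[where A = "arcs G"])
  also have "\<dots> = (\<Sum>r\<in>Or. \<Sum>s\<in>De. \<Sum>k\<in>routes G r s. (f r s k - fs r s k) * route_time G t xs k)"
    by (simp add: route_time_def sum_distrib_left)
  finally have 5: "(\<Sum>a\<in>arcs G. (x a - xs a) * t a (xs a)) = \<dots>" .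
  show ?thesis
    unfolding VI_lhs_def 1 2 3 4 5 sum_dest_routes[symmetric]
    by (simp add: gen_cost_def sum.distrib sum_subtractf algebra_simps)
qed

text \<open>The test point is the uniform flow, all of whose components at origins with demand are
  positive, so a vanishing reference component would contribute a positive multiple of \<open>ln 0\<close>. No
  term is \<open>\<infinity>\<close>, for which \<open>\<alpha> \<ge> \<gamma>\<close> is needed: it makes the coefficient of \<open>ln q\<close> nonnegative.\<close>

lemma VI_solution_positive:
  assumes VI: "VI_solution G Or De dem T t A B \<alpha> \<beta> \<gamma> fs xs qs ds hs"
  shows "positive_flows"
proof -
  define f where "f r s k = dem r / card (dest_routes r)" for r s :: 'v and k :: "'e awalk"
  define h where "h s = T / card De" for s :: 'v
  have card: "0 < card (dest_routes r)" if "r \<in> Or" for r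
    using De_nonempty routes_nonempty[OF that] by (auto simp: card_gt_0_iff)
  have f_nonneg: "0 \<le> f r s k" if "r \<in> Or" for r s k
    using dem_nonneg[OF that] by (simp add: f_def del: card_SigmaI)
  have h_pos: "0 < h s" for s
    using T De_nonempty by (simp add: h_def card_gt_0_iff)
  have f_sum: "(\<Sum>(s, k)\<in>dest_routes r. f r s k) = dem r" if "r \<in> Or" for r
    unfolding f_def split_def using card[OF that] by (auto simp del: card_SigmaI)
  obtain x q d where K: "(f, x, q, d) \<in> K1 G Or De dem"
    using f_nonneg f_sum by (rule K1_extend)
  have Kh: "h \<in> K2 De T"
    using h_pos De_nonempty by (simp add: K2_def less_imp_le) (simp add: h_def)
  define F where "F r s k = ereal (f r s k - fs r s k) * (ereal (1 / \<alpha>) * eln (fs r s k))" for r s k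
  define Q where "Q r s = ereal (q r s - qs r s) * (ereal (1 / \<gamma> - 1 / \<alpha>) * eln (qs r s))" for r s
  define H where
    "H s = ereal (h s - hs s) * (ereal (1 / \<beta>) * eln (hs s) - ereal (B s (ds s) (hs s)))" for s
  have F_fin: "F r s k \<noteq> \<infinity>" if "r \<in> Or" "s \<in> De" "k \<in> routes G r s" for r s k
    unfolding F_def using that f_nonneg K1D(1)[OF K1s] \<alpha> by (intro eln_term_not_PInfty) auto
  have Q_fin: "Q r s \<noteq> \<infinity>" if "r \<in> Or" "s \<in> De" for r s
    unfolding Q_def using that K1_demand_nonneg[OF K] K1_demand_nonneg[OF K1s] demand_coeff_nonneg
    by (intro eln_term_not_PInfty) auto
  have hs_nonneg: "0 \<le> hs s" if "s \<in> De" for s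
    using K2s that by (simp add: K2_def)
  have H_fin: "H s \<noteq> \<infinity>" and H_inf: "hs s = 0 \<Longrightarrow> H s = - \<infinity>" if "s \<in> De" for s
    using hs_nonneg[OF that] h_pos[of s] \<beta> by (auto simp: H_def eln_def)
  have F1_fin: "(\<Sum>k\<in>routes G r s. F r s k) \<noteq> \<infinity>" if "r \<in> Or" "s \<in> De" for r s
    using F_fin[OF that] by (auto simp: sum_Pinfty)
  have F2_fin: "(\<Sum>s\<in>De. \<Sum>k\<in>routes G r s. F r s k) \<noteq> \<infinity>" if "r \<in> Or" for r
    using F1_fin[OF that] by (auto simp: sum_Pinfty)
  have sums_fin: "(\<Sum>r\<in>Or. \<Sum>s\<in>De. \<Sum>k\<in>routes G r s. F r s k) \<noteq> \<infinity>"
    "(\<Sum>r\<in>Or. \<Sum>s\<in>De. Q r s) \<noteq> \<infinity>" "(\<Sum>s\<in>De. H s) \<noteq> \<infinity>"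
    using F2_fin Q_fin H_fin by (auto simp: sum_Pinfty)
  have "0 \<le> VI_lhs G Or De t A B \<alpha> \<beta> \<gamma> fs xs qs ds hs f x q d h"
    using VI K Kh by (auto simp: VI_solution_def)
  then have "VI_lhs G Or De t A B \<alpha> \<beta> \<gamma> fs xs qs ds hs f x q d h \<noteq> - \<infinity>"
    by auto
  then have F_sum: "(\<Sum>r\<in>Or. \<Sum>s\<in>De. \<Sum>k\<in>routes G r s. F r s k) \<noteq> - \<infinity>"
    and H_sum: "(\<Sum>s\<in>De. H s) \<noteq> - \<infinity>"
    using sums_fin unfolding VI_lhs_def F_def[symmetric] Q_def[symmetric] H_def[symmetric]
    by (auto simp: minus_ereal_def)
  have F_not_inf: "F r s k \<noteq> - \<infinity>" if rsk: "r \<in> Or" "s \<in> De" "k \<in> routes G r s" for r s k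
  proof -
    have "(\<Sum>s\<in>De. \<Sum>k\<in>routes G r s. F r s k) \<noteq> - \<infinity>"
      using F_sum F2_fin rsk(1) by (simp add: sum_eq_MInfty_iff)
    then have "(\<Sum>k\<in>routes G r s. F r s k) \<noteq> - \<infinity>"
      using F1_fin[OF rsk(1)] rsk(2) by (simp add: sum_eq_MInfty_iff)
    then show ?thesis
      using F_fin[OF rsk(1,2)] rsk(3) by (simp add: sum_eq_MInfty_iff)
  qed
  have "0 < fs r s k" if "r \<in> Or" "0 < dem r" "s \<in> De" "k \<in> routes G r s" for r s k
  proof -
    have "0 < f r s k"
      using card[OF that(1)] that(2) by (simp add: f_def del: card_SigmaI)
    then have "fs r s k \<noteq> 0"
      using F_not_inf[OF that(1,3,4)] eln_term_MInfty[of "1 / \<alpha>"] \<alpha> by (auto simp: F_def)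
    then show ?thesis
      using K1D(1)[OF K1s that(1,3,4)] by simp
  qed
  moreover have "0 < hs s" if "s \<in> De" for s
  proof -
    have "H s \<noteq> - \<infinity>"
      using H_sum H_fin that by (simp add: sum_eq_MInfty_iff)
    then show ?thesis
      using H_inf[OF that] hs_nonneg[OF that] by force
  qed
  ultimately show ?thesis
    by (simp add: positive_flows_def)
qed

text \<open>Since the feasible set is a product, one block can be varied while the others stay at
  the reference point, so the inequality decouples into one minimality statement per simplex.\<close>

lemma VI_solution_iff_costs_constant:
  assumes pos: "positive_flows"
  shows "VI_solution G Or De dem T t A B \<alpha> \<beta> \<gamma> fs xs qs ds hs \<longleftrightarrow>
    (\<forall>r\<in>Or. 0 < dem r \<longrightarrow> (\<lambda>(s, k). gen_cost r s k) constant_on dest_routes r) \<and>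
    bus_cost constant_on De"
    (is "_ \<longleftrightarrow> ?gen \<and> ?bus")
proof -
  have gen: "(\<lambda>(s, k). gen_cost r s k) constant_on dest_routes r \<longleftrightarrow>
      (\<forall>v. (\<forall>i\<in>dest_routes r. 0 \<le> v i) \<and> sum v (dest_routes r) = dem r \<longrightarrow>
        0 \<le> (\<Sum>(s, k)\<in>dest_routes r. (v (s, k) - fs r s k) * gen_cost r s k))"
    if r: "r \<in> Or" "0 < dem r" for r
    using simplex_minimal_iff_constant[of "dest_routes r" "\<lambda>(s, k). fs r s k"
        "\<lambda>(s, k). gen_cost r s k"] pos r K1_sum_flow[OF K1s r(1)]
    by (auto simp: positive_flows_def split_def)
  have hs_sum: "sum hs De = T"
    using K2s by (simp add: K2_def)
  have bus: "?bus \<longleftrightarrow> (\<forall>h\<in>K2 De T. 0 \<le> (\<Sum>s\<in>De. (h s - hs s) * bus_cost s))"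
    using simplex_minimal_iff_constant[of De hs bus_cost] pos
    by (auto simp: positive_flows_def K2_def hs_sum)
  show ?thesis
  proof
    assume VI: "VI_solution G Or De dem T t A B \<alpha> \<beta> \<gamma> fs xs qs ds hs"
    have lin: "0 \<le> (\<Sum>r\<in>Or. \<Sum>(s, k)\<in>dest_routes r. (f r s k - fs r s k) * gen_cost r s k)
        + (\<Sum>s\<in>De. (h s - hs s) * bus_cost s)"
      if K: "(f, x, q, d) \<in> K1 G Or De dem" and h: "h \<in> K2 De T" for f x q d h
    proof -
      have "0 \<le> VI_lhs G Or De t A B \<alpha> \<beta> \<gamma> fs xs qs ds hs f x q d h"
        using VI K h by (auto simp: VI_solution_def)
      then show ?thesis
        unfolding VI_lhs_linear[OF pos K] by simp
    qed
    have ?gen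
    proof (intro ballI impI)
      fix r assume r: "r \<in> Or" "0 < dem r"
      have "0 \<le> (\<Sum>(s, k)\<in>dest_routes r. (v (s, k) - fs r s k) * gen_cost r s k)"
        if v: "\<forall>i\<in>dest_routes r. 0 \<le> v i" "sum v (dest_routes r) = dem r" for v
      proof -
        define f where "f r' s k = (if r' = r then v (s, k) else fs r' s k)" for r' s k
        have "0 \<le> f r' s k" if "r' \<in> Or" "s \<in> De" "k \<in> routes G r' s" for r' s k
          using v(1) K1D(1)[OF K1s] that by (auto simp: f_def)
        moreover have "(\<Sum>(s, k)\<in>dest_routes r'. f r' s k) = dem r'" if "r' \<in> Or" for r'
          using v(2) K1_sum_flow[OF K1s that] by (cases "r' = r") (simp_all add: f_def)
        ultimately obtain x q d where "(f, x, q, d) \<in> K1 G Or De dem"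
          by (rule K1_extend)
        then have "0 \<le> (\<Sum>r'\<in>Or. \<Sum>(s, k)\<in>dest_routes r'.
            (f r' s k - fs r' s k) * gen_cost r' s k)"
          using lin[OF _ K2s] by simp
        also have "\<dots> = (\<Sum>r'\<in>Or. if r' = r then
            \<Sum>(s, k)\<in>dest_routes r. (v (s, k) - fs r s k) * gen_cost r s k else 0)"
          by (intro sum.cong refl) (simp add: f_def)
        finally show ?thesis
          using r(1) by simp
      qed
      then show "(\<lambda>(s, k). gen_cost r s k) constant_on dest_routes r"
        unfolding gen[OF r] by blast
    qed
    moreover have ?bus
      unfolding bus using lin[OF K1s] by simp
    ultimately show "?gen \<and> ?bus" ..
  next
    assume costs: "?gen \<and> ?bus"
    have "0 \<le> VI_lhs G Or De t A B \<alpha> \<beta> \<gamma> fs xs qs ds hs f x q d h"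
      if K: "(f, x, q, d) \<in> K1 G Or De dem" and h: "h \<in> K2 De T" for f x q d h
    proof -
      have "0 \<le> (\<Sum>(s, k)\<in>dest_routes r. (f r s k - fs r s k) * gen_cost r s k)" if r: "r \<in> Or" for r
      proof (cases "0 < dem r")
        case True
        have "\<forall>v. (\<forall>i\<in>dest_routes r. 0 \<le> v i) \<and> sum v (dest_routes r) = dem r \<longrightarrow>
          0 \<le> (\<Sum>(s, k)\<in>dest_routes r. (v (s, k) - fs r s k) * gen_cost r s k)"
          using gen[OF r True] costs r True by blast
        from this[rule_format, of "\<lambda>(s, k). f r s k"] show ?thesis
          using K1D(1)[OF K r] K1_sum_flow[OF K r] by auto
      next
        case False
        then have "dem r = 0"
          using dem_nonneg[OF r] by simp
        then have "(\<Sum>(s, k)\<in>dest_routes r. (f r s k - fs r s k) * gen_cost r s k) = 0"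
          using K1_zero_demand(2)[OF K r] K1_zero_demand(2)[OF K1s r]
          by (intro sum.neutral) auto
        then show ?thesis by simp
      qed
      moreover have "0 \<le> (\<Sum>s\<in>De. (h s - hs s) * bus_cost s)"
        using costs bus h by blast
      ultimately show ?thesis
        unfolding VI_lhs_linear[OF pos K] by (simp add: sum_nonneg)
    qed
    then show "VI_solution G Or De dem T t A B \<alpha> \<beta> \<gamma> fs xs qs ds hs"
      by (auto simp: VI_solution_def)
  qed
qed

section \<open>The equilibrium as equality of costs\<close>

abbreviation route_logit :: "'v \<Rightarrow> 'v \<Rightarrow> bool" where
  "route_logit r s \<equiv> \<forall>k\<in>routes G r s. fs r s k =
     qs r s * (exp (- \<alpha> * route_time G t xs k) / (\<Sum>j\<in>routes G r s. exp (- \<alpha> * route_time G t xs j)))"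

abbreviation dest_utility :: "'v \<Rightarrow> 'v \<Rightarrow> real" where
  "dest_utility r s \<equiv> - \<gamma> * (expected_time G t \<alpha> xs r s - A s (ds s) (hs s))"

abbreviation dest_logit :: "'v \<Rightarrow> bool" where
  "dest_logit r \<equiv> \<forall>s\<in>De. qs r s =
     dem r * (exp (dest_utility r s) / (\<Sum>j\<in>De. exp (dest_utility r j)))"

abbreviation bus_logit :: bool where
  "bus_logit \<equiv> \<forall>s\<in>De. hs s =
     T * (exp (\<beta> * B s (ds s) (hs s)) / (\<Sum>j\<in>De. exp (\<beta> * B j (ds j) (hs j))))"

lemma combined_equilibrium_iff:
  "combined_equilibrium G Or De dem T t A B \<alpha> \<beta> \<gamma> fs xs qs ds hs \<longleftrightarrow>
    (\<forall>r\<in>Or. dest_logit r \<and> (\<forall>s\<in>De. route_logit r s)) \<and> bus_logit"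
  using K1s K2s unfolding combined_equilibrium_def by blast

lemma combined_equilibrium_positive:
  assumes "combined_equilibrium G Or De dem T t A B \<alpha> \<beta> \<gamma> fs xs qs ds hs"
  shows "positive_flows"
proof -
  have share: "0 < exp (w i) / (\<Sum>j\<in>I. exp (w j))" if "finite I" "i \<in> I"
    for I :: "'i set" and w :: "'i \<Rightarrow> real" and i
    using that by (intro divide_pos_pos sum_pos) auto
  note logit = assms[unfolded combined_equilibrium_iff]
  have q: "0 < qs r s" if "r \<in> Or" "0 < dem r" "s \<in> De" for r s
  proof -
    have "qs r s = dem r * (exp (dest_utility r s) / (\<Sum>j\<in>De. exp (dest_utility r j)))"
      using logit that by blast
    also have "0 < \<dots>"
      using that by (intro mult_pos_pos share) auto
    finally show ?thesis .
  qed
  have f: "0 < fs r s k" if "r \<in> Or" "0 < dem r" "s \<in> De" "k \<in> routes G r s" for r s k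
  proof -
    have "fs r s k = qs r s * (exp (- \<alpha> * route_time G t xs k)
        / (\<Sum>j\<in>routes G r s. exp (- \<alpha> * route_time G t xs j)))"
      using logit that by blast
    also have "0 < \<dots>"
      using that by (intro mult_pos_pos share q) auto
    finally show ?thesis .
  qed
  have "0 < hs s" if "s \<in> De" for s
  proof -
    have "hs s = T * (exp (\<beta> * B s (ds s) (hs s)) / (\<Sum>j\<in>De. exp (\<beta> * B j (ds j) (hs j))))"
      using logit that by blast
    also have "0 < \<dots>"
      using that T by (intro mult_pos_pos share) auto
    finally show ?thesis .
  qed
  with f show ?thesis
    by (simp add: positive_flows_def)
qed

text \<open>Under the route split, \<open>(1/\<alpha>) ln f\<close> is \<open>(1/\<alpha>) ln q\<close> minus the route time plus the expected
  time, so the route time cancels and the coefficients of \<open>ln q\<close> add up to \<open>1/\<gamma>\<close>. This is why the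
  demand term of the variational inequality carries the factor \<open>1/\<gamma> - 1/\<alpha>\<close>.\<close>

lemma gen_cost_route_logit:
  assumes "route_logit r s" and "0 < qs r s" and k: "k \<in> routes G r s"
  shows "gen_cost r s k = (ln (qs r s) - dest_utility r s) / \<gamma>"
proof -
  define S where "S = (\<Sum>j\<in>routes G r s. exp (- \<alpha> * route_time G t xs j))"
  have S: "0 < S"
    unfolding S_def using k by (intro sum_pos) auto
  have "fs r s k = qs r s * (exp (- \<alpha> * route_time G t xs k) / S)"
    using assms(1) k unfolding S_def by blast
  then have ln_f: "ln (fs r s k) = ln (qs r s) + (- \<alpha> * route_time G t xs k - ln S)"
    using S assms(2) by (simp add: ln_mult ln_div)
  have v: "expected_time G t \<alpha> xs r s = - (1 / \<alpha>) * ln S"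
    by (simp add: expected_time_def S_def)
  show ?thesis
    using \<alpha> \<gamma> unfolding gen_cost_def ln_f v by (simp add: field_simps)
qed

lemma logit_iff_gen_cost_constant:
  assumes pos: "positive_flows" and r: "r \<in> Or" "0 < dem r"
  shows "dest_logit r \<and> (\<forall>s\<in>De. route_logit r s) \<longleftrightarrow>
    (\<lambda>(s, k). gen_cost r s k) constant_on dest_routes r"
proof -
  have q: "0 < qs r s" if "s \<in> De" for s
    using demand_pos[OF pos r that] .
  have route: "route_logit r s \<longleftrightarrow>
      (\<lambda>k. ln (fs r s k) - - \<alpha> * route_time G t xs k) constant_on routes G r s" if "s \<in> De" for s
    using logit_iff_constant[of "routes G r s" "fs r s" "\<lambda>k. - \<alpha> * route_time G t xs k"]
      routes_nonempty[OF r(1) that] K1D(2)[OF K1s r(1) that] pos r that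
    by (simp add: positive_flows_def)
  have dest: "dest_logit r \<longleftrightarrow> (\<lambda>s. ln (qs r s) - dest_utility r s) constant_on De"
    using logit_iff_constant[of De "qs r" "dest_utility r"] De_nonempty q K1D(3)[OF K1s r(1)]
    by simp
  show ?thesis
  proof
    assume logit: "dest_logit r \<and> (\<forall>s\<in>De. route_logit r s)"
    then obtain y where y: "\<And>s. s \<in> De \<Longrightarrow> ln (qs r s) - dest_utility r s = y"
      unfolding dest constant_on_def by blast
    have "gen_cost r s k = y / \<gamma>" if "s \<in> De" "k \<in> routes G r s" for s k
      using gen_cost_route_logit[OF _ q[OF that(1)] that(2)] logit that(1) y[OF that(1)] by simp
    then show "(\<lambda>(s, k). gen_cost r s k) constant_on dest_routes r"
      unfolding constant_on_def by auto
  next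
    assume "(\<lambda>(s, k). gen_cost r s k) constant_on dest_routes r"
    then obtain y where "\<forall>i\<in>dest_routes r. (case i of (s, k) \<Rightarrow> gen_cost r s k) = y"
      unfolding constant_on_def by blast
    then have y: "gen_cost r s k = y" if "s \<in> De" "k \<in> routes G r s" for s k
      using that by auto
    have rl: "route_logit r s" if s: "s \<in> De" for s
    proof -
      have "ln (fs r s k) - - \<alpha> * route_time G t xs k
          = \<alpha> * (y - (1 / \<gamma> - 1 / \<alpha>) * ln (qs r s) + A s (ds s) (hs s))"
        if "k \<in> routes G r s" for k
        using y[OF s that, symmetric] \<alpha> by (simp add: gen_cost_def distrib_left)
      then show ?thesis
        unfolding route[OF s] constant_on_def by blast
    qed
    have "ln (qs r s) - dest_utility r s = \<gamma> * y" if s: "s \<in> De" for s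
    proof -
      obtain k where k: "k \<in> routes G r s"
        using routes_nonempty[OF r(1) s] by blast
      show ?thesis
        using gen_cost_route_logit[OF rl[OF s] q[OF s] k] y[OF s k] \<gamma> by simp
    qed
    then have "dest_logit r"
      unfolding dest constant_on_def by blast
    with rl show "dest_logit r \<and> (\<forall>s\<in>De. route_logit r s)"
      by blast
  qed
qed

lemma bus_logit_iff_constant:
  assumes pos: "positive_flows"
  shows "bus_logit \<longleftrightarrow> bus_cost constant_on De"
proof -
  have "bus_logit \<longleftrightarrow> (\<lambda>s. ln (hs s) - \<beta> * B s (ds s) (hs s)) constant_on De"
    using logit_iff_constant[of De hs "\<lambda>s. \<beta> * B s (ds s) (hs s)"] De_nonempty pos K2s
    by (simp add: positive_flows_def K2_def)
  also have "(\<lambda>s. ln (hs s) - \<beta> * B s (ds s) (hs s)) = (\<lambda>s. \<beta> * bus_cost s)"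
    using \<beta> by (auto simp: bus_cost_def field_simps)
  also have "\<dots> constant_on De \<longleftrightarrow> bus_cost constant_on De"
    using \<beta> unfolding constant_on_def by (metis mult_cancel_left less_irrefl)
  finally show ?thesis .
qed

lemma zero_demand_logit:
  assumes "r \<in> Or" and "dem r = 0"
  shows "dest_logit r \<and> (\<forall>s\<in>De. route_logit r s)"
  using K1_zero_demand[OF K1s assms] assms(2) by simp

lemma combined_equilibrium_iff_costs_constant:
  assumes pos: "positive_flows"
  shows "combined_equilibrium G Or De dem T t A B \<alpha> \<beta> \<gamma> fs xs qs ds hs \<longleftrightarrow>
    (\<forall>r\<in>Or. 0 < dem r \<longrightarrow> (\<lambda>(s, k). gen_cost r s k) constant_on dest_routes r) \<and>
    bus_cost constant_on De"
proof -
  have "(dest_logit r \<and> (\<forall>s\<in>De. route_logit r s)) \<longleftrightarrow>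
      (0 < dem r \<longrightarrow> (\<lambda>(s, k). gen_cost r s k) constant_on dest_routes r)" if "r \<in> Or" for r
  proof (cases "0 < dem r")
    case True
    then show ?thesis
      using logit_iff_gen_cost_constant[OF pos that] by blast
  next
    case False
    then have "dem r = 0"
      using dem_nonneg[OF that] by simp
    with False show ?thesis
      using zero_demand_logit[OF that] by blast
  qed
  then show ?thesis
    unfolding combined_equilibrium_iff bus_logit_iff_constant[OF pos] by (metis (no_types, lifting))
qed

lemma VI_solution_iff_combined_equilibrium:
  "VI_solution G Or De dem T t A B \<alpha> \<beta> \<gamma> fs xs qs ds hs \<longleftrightarrow>
   combined_equilibrium G Or De dem T t A B \<alpha> \<beta> \<gamma> fs xs qs ds hs"
  using VI_solution_positive combined_equilibrium_positive
    VI_solution_iff_costs_constant combined_equilibrium_iff_costs_constant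
  by blast

end

theorem mainTheorem4:
  fixes G :: "('v, 'e) pre_digraph"
    and Or De :: "'v set"
    and dem :: "'v \<Rightarrow> real"
    and T \<alpha> \<beta> \<gamma> :: real
    and t :: "'e \<Rightarrow> real \<Rightarrow> real"
    and A B :: "'v \<Rightarrow> real \<Rightarrow> real \<Rightarrow> real"
    and fs :: "('v, 'e) path_flow" and xs :: "'e link_flow"
    and qs :: "'v od_demand" and ds hs :: "'v dest_vec"
  assumes "fin_digraph G"
    and "Or \<subseteq> verts G" and "De \<subseteq> verts G"
    and "\<And>r s. r \<in> Or \<Longrightarrow> s \<in> De \<Longrightarrow> routes G r s \<noteq> {}"
    and "T > 0" and "\<alpha> > 0" and "\<beta> > 0" and "\<gamma> > 0" and "\<alpha> \<ge> \<gamma>"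
    and "\<And>a. a \<in> arcs G \<Longrightarrow> link_time (t a)"
    and "\<And>s. s \<in> De \<Longrightarrow> trip_attraction (A s)"
    and "\<And>s. s \<in> De \<Longrightarrow> business_attraction (B s)"
    and "(fs, xs, qs, ds) \<in> K1 G Or De dem"
    and "hs \<in> K2 De T"
  shows "VI_solution G Or De dem T t A B \<alpha> \<beta> \<gamma> fs xs qs ds hs \<longleftrightarrow>
         combined_equilibrium G Or De dem T t A B \<alpha> \<beta> \<gamma> fs xs qs ds hs"
proof -
  interpret fin_digraph G by fact
  interpret land_use G Or De dem T \<alpha> \<beta> \<gamma> t A B fs xs qs ds hs
    by unfold_locales (use assms finite_subset[OF _ finite_verts] in auto)
  show ?thesis
    by (rule VI_solution_iff_combined_equilibrium)
qed

end
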